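(* Let $A\in M_n(\mathbb H)$ with $n\ge2$, and let $\lambda_1,\dots,\lambda_n$ be the standard eigenvalues of $A$. Then $$T_{\mathbb H,2}(A)=\sum_{k=1}^n|\lambda_k|^2+4\sum_{k=1}^{n-1}\sum_{m=k+1}^n\mathrm{Re}(\lambda_k)\,\mathrm{Re}(\lambda_m).$$
   Context: $\mathbb H$ denotes the quaternions. For $A=(a_{\ell m})\in M_n(\mathbb H)$, write $A=A_1+A_2j$ with $A_1,A_2\in M_n(\mathbb C)$; the companion matrix is $\chi_A=\begin{pmatrix}A_1&A_2\\ -\overline{A_2}&\overline{A_1}\end{pmatrix}\in M_{2n}(\mathbb C)$. The first-order trace is $T_{\mathbb H,1}(A)=\mathrm{Tr}\,\chi_A=2\,\mathrm{Re}(\sum_\ell a_{\ell\ell})$, and the second-order trace is $T_{\mathbb H,2}(A)=\frac12\begin{vmatrix} T_{\mathbb H,1}(A)&1\\ T_{\mathbb H,1}(A^2)&T_{\mathbb H,1}(A)\end{vmatrix}$. The standard eigenvalues $\lambda_1,\dots,\lambda_n$ of $A$ are the representatives, lying in $\mathbb C$ with imaginary part $\ge0$, of the similarity classes $[\lambda]=\{s^{-1}\lambda s:s\in\mathbb H\setminus\{0\}\}$ of right eigenvalues of $A$ (i.e. $Ax=x\lambda$, $x\neq0$), counted with multiplicity so that the eigenvalues of $\chi_A$ with algebraic multiplicity are $\lambda_1,\overline{\lambda_1},\dots,\lambda_n,\overline{\lambda_n}$. *)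

theory Defs
  imports "Jordan_Normal_Form.Char_Poly"
begin

section \<open>The skew field of quaternions\<close>

text \<open>\<open>Quat a b c d\<close> is $a + bi + cj + dk$ with $i^2 = j^2 = k^2 = ijk = -1$.\<close>

datatype quat = Quat (QRe: real) (QIm1: real) (QIm2: real) (QIm3: real)

lemma quat_eq_iff:
  "p = q \<longleftrightarrow> QRe p = QRe q \<and> QIm1 p = QIm1 q \<and> QIm2 p = QIm2 q \<and> QIm3 p = QIm3 q"
  by (cases p; cases q) auto

instantiation quat :: division_ring
begin

definition zero_quat :: quat where "0 = Quat 0 0 0 0"

definition one_quat :: quat where "1 = Quat 1 0 0 0"

definition plus_quat :: "quat \<Rightarrow> quat \<Rightarrow> quat" where
  "p + q = Quat (QRe p + QRe q) (QIm1 p + QIm1 q) (QIm2 p + QIm2 q) (QIm3 p + QIm3 q)"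

definition uminus_quat :: "quat \<Rightarrow> quat" where
  "- q = Quat (- QRe q) (- QIm1 q) (- QIm2 q) (- QIm3 q)"

definition minus_quat :: "quat \<Rightarrow> quat \<Rightarrow> quat" where
  "p - q = Quat (QRe p - QRe q) (QIm1 p - QIm1 q) (QIm2 p - QIm2 q) (QIm3 p - QIm3 q)"

definition times_quat :: "quat \<Rightarrow> quat \<Rightarrow> quat" where
  "p * q = Quat
     (QRe p * QRe q - QIm1 p * QIm1 q - QIm2 p * QIm2 q - QIm3 p * QIm3 q)
     (QRe p * QIm1 q + QIm1 p * QRe q + QIm2 p * QIm3 q - QIm3 p * QIm2 q)
     (QRe p * QIm2 q - QIm1 p * QIm3 q + QIm2 p * QRe q + QIm3 p * QIm1 q)
     (QRe p * QIm3 q + QIm1 p * QIm2 q - QIm2 p * QIm1 q + QIm3 p * QRe q)"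

definition inverse_quat :: "quat \<Rightarrow> quat" where
  "inverse q = (let N = (QRe q)\<^sup>2 + (QIm1 q)\<^sup>2 + (QIm2 q)\<^sup>2 + (QIm3 q)\<^sup>2
     in Quat (QRe q / N) (- QIm1 q / N) (- QIm2 q / N) (- QIm3 q / N))"

definition divide_quat :: "quat \<Rightarrow> quat \<Rightarrow> quat" where
  "p div q = p * inverse (q :: quat)"

lemmas quat_ops_defs = zero_quat_def one_quat_def plus_quat_def uminus_quat_def
  minus_quat_def times_quat_def

lemma quat_norm_nonzero:
  assumes "q \<noteq> (0 :: quat)"
  shows "(QRe q)\<^sup>2 + (QIm1 q)\<^sup>2 + (QIm2 q)\<^sup>2 + (QIm3 q)\<^sup>2 \<noteq> 0"
  using assms by (auto simp: quat_eq_iff zero_quat_def add_nonneg_eq_0_iff)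

instance
proof
  fix p q r :: quat
  show "p + q + r = p + (q + r)" "p + q = q + p" "0 + p = p" "- p + p = 0" "p - q = p + - q"
    "1 * p = p" "p * 1 = p"
    by (simp_all add: quat_ops_defs quat_eq_iff)
  show "p * q * r = p * (q * r)" "(p + q) * r = p * r + q * r" "p * (q + r) = p * q + p * r"
    by (simp_all add: quat_ops_defs quat_eq_iff algebra_simps)
  show "(0 :: quat) \<noteq> 1" by (simp add: quat_ops_defs)
  show "inverse (0 :: quat) = 0" by (simp add: inverse_quat_def zero_quat_def)
  show "p div q = p * inverse q" by (rule divide_quat_def)
next
  fix q :: quat
  assume "q \<noteq> 0"
  from quat_norm_nonzero[OF this]
  show "inverse q * q = 1" "q * inverse q = 1"
    by (simp_all add: inverse_quat_def times_quat_def one_quat_def Let_def power2_eq_square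
        flip: add_divide_distrib diff_divide_distrib)
qed

end

definition quat_j :: quat where "quat_j = Quat 0 0 1 0"

definition quat_of_complex :: "complex \<Rightarrow> quat" where
  "quat_of_complex z = Quat (Re z) (Im z) 0 0"

text \<open>The two complex parts $a_1, a_2$ of a quaternion $a = a_1 + a_2 j$.\<close>

definition quat_fst :: "quat \<Rightarrow> complex" where
  "quat_fst q = Complex (QRe q) (QIm1 q)"

definition quat_snd :: "quat \<Rightarrow> complex" where
  "quat_snd q = Complex (QIm2 q) (QIm3 q)"

lemma quat_decomp:
  "q = quat_of_complex z + quat_of_complex w * quat_j \<longleftrightarrow> z = quat_fst q \<and> w = quat_snd q"
  by (auto simp: quat_eq_iff quat_ops_defs quat_j_def quat_of_complex_def quat_fst_def
      quat_snd_def complex_eq_iff)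

section \<open>Companion matrix and traces\<close>

definition companion_mat :: "quat mat \<Rightarrow> complex mat" where
  "companion_mat A =
     (let A1 = map_mat quat_fst A; A2 = map_mat quat_snd A
      in four_block_mat A1 A2 (- map_mat cnj A2) (map_mat cnj A1))"

definition mat_trace :: "'a :: comm_monoid_add mat \<Rightarrow> 'a" where
  "mat_trace A = (\<Sum>i<dim_row A. A $$ (i, i))"

definition trace_H1 :: "quat mat \<Rightarrow> complex" where
  "trace_H1 A = mat_trace (companion_mat A)"

lemma trace_H1_eq:
  assumes "A \<in> carrier_mat n n"
  shows "trace_H1 A = of_real (2 * QRe (mat_trace A))"
proof -
  have QRe_sum: "QRe (\<Sum>i\<in>I. f i) = (\<Sum>i\<in>I. QRe (f i))" for f :: "nat \<Rightarrow> quat" and I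
    by (induction I rule: infinite_finite_induct) (auto simp: zero_quat_def plus_quat_def)
  have split: "(\<Sum>i<n + m. f i) = (\<Sum>i<n. f i) + (\<Sum>i<m. f (n + i))"
    for f :: "nat \<Rightarrow> complex" and m
    by (induction m) (simp_all add: add.assoc)
  let ?f = "\<lambda>i. companion_mat A $$ (i, i)"
  have dim: "dim_row (companion_mat A) = n + n"
    using assms by (simp add: companion_mat_def Let_def)
  have "trace_H1 A = (\<Sum>i<n + n. ?f i)"
    by (simp add: trace_H1_def mat_trace_def dim)
  also have "\<dots> = (\<Sum>i<n. ?f i) + (\<Sum>i<n. ?f (n + i))"
    using split by blast
  also have "(\<Sum>i<n. ?f i) = (\<Sum>i<n. quat_fst (A $$ (i, i)))"
    using assms by (intro sum.cong) (auto simp: companion_mat_def Let_def)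
  also have "(\<Sum>i<n. ?f (n + i)) = (\<Sum>i<n. cnj (quat_fst (A $$ (i, i))))"
    using assms by (intro sum.cong) (auto simp: companion_mat_def Let_def)
  also have "(\<Sum>i<n. quat_fst (A $$ (i, i))) + \<dots> = (\<Sum>i<n. of_real (2 * QRe (A $$ (i, i))))"
    by (simp add: quat_fst_def complex_eq_iff flip: sum.distrib)
  also have "\<dots> = of_real (2 * QRe (mat_trace A))"
    using assms by (simp add: mat_trace_def QRe_sum sum_distrib_left)
  finally show ?thesis .
qed

definition trace_H2 :: "quat mat \<Rightarrow> complex" where
  "trace_H2 A = 1 / 2 * det (mat_of_rows_list 2
     [[trace_H1 A, 1],
      [trace_H1 (A ^\<^sub>m 2), trace_H1 A]])"

section \<open>Standard eigenvalues\<close>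

definition right_eigenvalue :: "quat mat \<Rightarrow> quat \<Rightarrow> bool" where
  "right_eigenvalue A q \<longleftrightarrow>
     (\<exists>x \<in> carrier_vec (dim_row A). x \<noteq> 0\<^sub>v (dim_row A) \<and> A *\<^sub>v x = map_vec (\<lambda>t. t * q) x)"

definition similarity_class :: "quat \<Rightarrow> quat set" where
  "similarity_class q = {inverse s * q * s | s. s \<noteq> 0}"

text \<open>
  The family \<open>l 1, \<dots>, l n\<close> lists the standard eigenvalues of an \<open>n \<times> n\<close> matrix \<open>A\<close>, in any order.
  The second conjunct says which similarity classes occur; the third fixes their multiplicities
  through the multiset of eigenvalues of the companion matrix.
\<close>

definition standard_eigenvalues :: "nat \<Rightarrow> quat mat \<Rightarrow> (nat \<Rightarrow> complex) \<Rightarrow> bool" where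
  "standard_eigenvalues n A l \<longleftrightarrow>
     (\<forall>k\<in>{1..n}. Im (l k) \<ge> 0) \<and>
     {similarity_class q | q. right_eigenvalue A q} =
       {similarity_class (quat_of_complex (l k)) | k. k \<in> {1..n}} \<and>
     proots (char_poly (companion_mat A)) =
       image_mset l (mset_set {1..n}) + image_mset (\<lambda>k. cnj (l k)) (mset_set {1..n})"

end

theory Submission
  imports Defs "Jordan_Normal_Form.Schur_Decomposition"
begin

text \<open>
  The eigenvalues of the companion matrix \<open>\<chi>\<^sub>A\<close>, with algebraic multiplicity, are the \<open>\<lambda>\<^sub>k\<close>
  and their conjugates. A complex matrix is similar to a triangular one, so the trace of its
  \<open>p\<close>-th power is the \<open>p\<close>-th power sum of its eigenvalues (\<open>mat_trace_pow_eq_sum_proots\<close>); and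
  \<open>A \<mapsto> \<chi>\<^sub>A\<close> is multiplicative (\<open>companion_mat_mult\<close>), so the first-order trace of \<open>A\<^sup>2\<close> is the
  trace of \<open>\<chi>\<^sub>A\<^sup>2\<close>. Conjugate pairs add up to twice their real part, whence the first-order traces
  of \<open>A\<close> and \<open>A\<^sup>2\<close> are \<open>2 \<Sum> Re \<lambda>\<^sub>k\<close> and \<open>2 \<Sum> ((Re \<lambda>\<^sub>k)\<^sup>2 - (Im \<lambda>\<^sub>k)\<^sup>2)\<close>.

  The second-order trace is half the difference between the square of the former and the latter,
  \<open>2 (\<Sum> Re \<lambda>\<^sub>k)\<^sup>2 - \<Sum> (Re \<lambda>\<^sub>k)\<^sup>2 + \<Sum> (Im \<lambda>\<^sub>k)\<^sup>2\<close>. Expanding the square of the sum turns the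
  diagonal terms into \<open>\<Sum> ((Re \<lambda>\<^sub>k)\<^sup>2 + (Im \<lambda>\<^sub>k)\<^sup>2)\<close> and leaves each mixed product with the
  coefficient 4.
\<close>

section \<open>Traces of powers and roots of the characteristic polynomial\<close>

lemma mat_trace_mult_commute:
  fixes A B :: "'a :: comm_semiring_0 mat"
  assumes A: "A \<in> carrier_mat m n" and B: "B \<in> carrier_mat n m"
  shows "mat_trace (A * B) = mat_trace (B * A)"
proof -
  have "mat_trace (A * B) = (\<Sum>i<m. \<Sum>j<n. A $$ (i, j) * B $$ (j, i))"
    using A B by (simp add: mat_trace_def scalar_prod_def lessThan_atLeast0)
  also have "\<dots> = (\<Sum>j<n. \<Sum>i<m. B $$ (j, i) * A $$ (i, j))"
    by (subst sum.swap) (simp add: mult.commute)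
  also have "\<dots> = mat_trace (B * A)"
    using A B by (simp add: mat_trace_def scalar_prod_def lessThan_atLeast0)
  finally show ?thesis .
qed

lemma mat_trace_similar:
  fixes A B :: "'a :: comm_ring_1 mat"
  assumes "similar_mat A B"
  shows "mat_trace A = mat_trace B"
proof -
  from similar_matD[OF assms] obtain n P Q where
    carr: "A \<in> carrier_mat n n" "B \<in> carrier_mat n n" "P \<in> carrier_mat n n" "Q \<in> carrier_mat n n"
    and QP: "Q * P = 1\<^sub>m n" and eq: "A = P * B * Q"
    by auto
  have "mat_trace A = mat_trace (Q * (P * B))"
    unfolding eq using carr by (intro mat_trace_mult_commute) auto
  also have "Q * (P * B) = B"
    using carr QP by (simp flip: assoc_mult_mat)
  finally show ?thesis .
qed

text \<open>
  In the sum over \<open>k\<close> of \<open>a\<^sub>i\<^sub>k b\<^sub>k\<^sub>i\<close>, the left factor vanishes for \<open>k < i\<close> and the right one for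
  \<open>k > i\<close>.
\<close>

lemma mat_diag_mult_upper_triangular:
  fixes A B :: "'a :: semiring_0 mat"
  assumes A: "A \<in> carrier_mat n n" "upper_triangular A"
    and B: "B \<in> carrier_mat n n" "upper_triangular B"
    and "i < n"
  shows "(A * B) $$ (i, i) = A $$ (i, i) * B $$ (i, i)"
proof -
  have "(A * B) $$ (i, i) = (\<Sum>k = 0..<n. A $$ (i, k) * B $$ (k, i))"
    using A B \<open>i < n\<close> by (simp add: scalar_prod_def)
  also have "\<dots> = (\<Sum>k \<in> {i}. A $$ (i, k) * B $$ (k, i))"
  proof (rule sum.mono_neutral_right)
    show "\<forall>k \<in> {0..<n} - {i}. A $$ (i, k) * B $$ (k, i) = 0"
    proof
      fix k assume k: "k \<in> {0..<n} - {i}"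
      then consider "k < i" | "i < k" by fastforce
      then show "A $$ (i, k) * B $$ (k, i) = 0"
        using upper_triangularD[OF A(2), of k i] upper_triangularD[OF B(2), of i k] A B k \<open>i < n\<close>
        by cases auto
    qed
  qed (use \<open>i < n\<close> in auto)
  finally show ?thesis by simp
qed

lemma upper_triangular_mult:
  fixes A B :: "'a :: semiring_0 mat"
  assumes A: "A \<in> carrier_mat n n" "upper_triangular A"
    and B: "B \<in> carrier_mat n n" "upper_triangular B"
  shows "upper_triangular (A * B)"
proof (rule upper_triangularI)
  fix j i assume ji: "j < i" "i < dim_row (A * B)"
  have "A $$ (i, k) * B $$ (k, j) = 0" if "k < n" for k
  proof (cases "k < i")
    case True
    then show ?thesis using upper_triangularD[OF A(2) True] A ji by auto
  next
    case False
    then show ?thesis using upper_triangularD[OF B(2), of j k] B that ji by auto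
  qed
  then show "(A * B) $$ (i, j) = 0"
    using A B ji by (auto simp: scalar_prod_def intro!: sum.neutral)
qed

lemma pow_mat_upper_triangular:
  fixes A :: "'a :: semiring_1 mat"
  assumes A: "A \<in> carrier_mat n n" "upper_triangular A"
  shows "upper_triangular (A ^\<^sub>m k) \<and> (\<forall>i<n. (A ^\<^sub>m k) $$ (i, i) = (A $$ (i, i)) ^ k)"
proof (induction k)
  case 0
  then show ?case using A by (auto simp: upper_triangular_def)
next
  case (Suc k)
  have Ak: "A ^\<^sub>m k \<in> carrier_mat n n" "upper_triangular (A ^\<^sub>m k)"
    using A Suc by simp_all
  then show ?case
    using Suc upper_triangular_mult[OF Ak A] mat_diag_mult_upper_triangular[OF Ak A]
    by (simp add: power_commutes del: index_mult_mat)
qed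

text \<open>
  By the Schur decomposition the matrix is similar to an upper triangular one whose diagonal lists
  the roots of the characteristic polynomial; similarity passes to powers and preserves the trace,
  and the diagonal of a power of a triangular matrix consists of the powers of its diagonal entries.
\<close>

lemma mat_trace_pow_eq_sum_proots:
  fixes A :: "complex mat"
  assumes A: "A \<in> carrier_mat n n"
  shows "mat_trace (A ^\<^sub>m k) = (\<Sum>e \<in># proots (char_poly A). e ^ k)"
proof -
  obtain es where es: "char_poly A = (\<Prod>a\<leftarrow>es. [:- a, 1:])"
    using char_poly_factorized[OF A] by blast
  obtain B P Q where "schur_decomposition A es = (B, P, Q)"
    by (cases "schur_decomposition A es") auto
  from schur_decomposition[OF A es this]
  have sim: "similar_mat_wit A B P Q" and ut: "upper_triangular B" and diag: "diag_mat B = es"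
    by auto
  have B: "B \<in> carrier_mat n n"
    using similar_mat_witD2[OF A sim] by simp
  have "mat_trace (A ^\<^sub>m k) = mat_trace (B ^\<^sub>m k)"
    using similar_mat_wit_pow[OF sim] by (intro mat_trace_similar) (auto simp: similar_mat_def)
  also have "\<dots> = (\<Sum>i<n. (B $$ (i, i)) ^ k)"
    using pow_mat_upper_triangular[OF B ut, of k] B by (simp add: mat_trace_def)
  also have "\<dots> = (\<Sum>e\<leftarrow>es. e ^ k)"
    using B by (simp add: diag[symmetric] diag_mat_def o_def interv_sum_list_conv_sum_set_nat lessThan_atLeast0)
  also have "mset es = proots (char_poly A)"
  proof -
    have "proots (\<Prod>a\<leftarrow>es. [:- a, 1:]) = mset es"
    proof (induction es)
      case (Cons a es)
      have nz: "(\<Prod>a\<leftarrow>es. [:- a, 1:]) \<noteq> 0"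
        by (auto simp: prod_list_zero_iff)
      have "proots ([:- a, 1:] * (\<Prod>a\<leftarrow>es. [:- a, 1:])) = {#a#} + mset es"
        using nz Cons.IH by (subst proots_mult) auto
      then show ?case by simp
    qed simp
    then show ?thesis using es by simp
  qed
  then have "(\<Sum>e\<leftarrow>es. e ^ k) = (\<Sum>e \<in># proots (char_poly A). e ^ k)"
    by (metis mset_map sum_mset_sum_list)
  finally show ?thesis .
qed

section \<open>The companion matrix of a product\<close>

lemma quat_fst_sum: "quat_fst (sum f I) = (\<Sum>i\<in>I. quat_fst (f i))"
  by (induction I rule: infinite_finite_induct)
    (auto simp: quat_fst_def zero_quat_def plus_quat_def complex_eq_iff)

lemma quat_snd_sum: "quat_snd (sum f I) = (\<Sum>i\<in>I. quat_snd (f i))"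
  by (induction I rule: infinite_finite_induct)
    (auto simp: quat_snd_def zero_quat_def plus_quat_def complex_eq_iff)

lemma quat_fst_mult:
  "quat_fst (p * q) = quat_fst p * quat_fst q - quat_snd p * cnj (quat_snd q)"
  by (simp add: quat_fst_def quat_snd_def times_quat_def complex_eq_iff)

lemma quat_snd_mult:
  "quat_snd (p * q) = quat_fst p * quat_snd q + quat_snd p * cnj (quat_fst q)"
  by (simp add: quat_fst_def quat_snd_def times_quat_def complex_eq_iff)

lemma companion_mat_carrier:
  assumes "A \<in> carrier_mat n n"
  shows "companion_mat A \<in> carrier_mat (n + n) (n + n)"
  using assms by (simp add: companion_mat_def Let_def)

text \<open>
  Moving \<open>j\<close> past a complex number conjugates it, so
  \<open>(A\<^sub>1 + A\<^sub>2 j) (B\<^sub>1 + B\<^sub>2 j) = (A\<^sub>1 B\<^sub>1 - A\<^sub>2 cnj B\<^sub>2) + (A\<^sub>1 B\<^sub>2 + A\<^sub>2 cnj B\<^sub>1) j\<close>. These two parts are the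
  upper blocks of the block product, and the lower blocks are their conjugates up to sign.
\<close>

lemma companion_mat_mult:
  assumes A: "A \<in> carrier_mat n n" and B: "B \<in> carrier_mat n n"
  shows "companion_mat (A * B) = companion_mat A * companion_mat B"
proof -
  let ?A1 = "map_mat quat_fst A" and ?A2 = "map_mat quat_snd A"
  let ?B1 = "map_mat quat_fst B" and ?B2 = "map_mat quat_snd B"
  let ?c = "map_mat cnj"
  have fst: "map_mat quat_fst (A * B) = ?A1 * ?B1 + ?A2 * (- ?c ?B2)"
    using A B by (intro eq_matI)
      (simp_all add: scalar_prod_def quat_fst_sum quat_fst_mult sum_subtractf sum_negf)
  have snd: "map_mat quat_snd (A * B) = ?A1 * ?B2 + ?A2 * ?c ?B1"
    using A B by (intro eq_matI)
      (simp_all add: scalar_prod_def quat_snd_sum quat_snd_mult sum.distrib)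
  have 1: "- ?c (map_mat quat_snd (A * B)) = - ?c ?A2 * ?B1 + ?c ?A1 * (- ?c ?B2)"
    using A B unfolding snd by (intro eq_matI)
      (simp_all add: scalar_prod_def sum_negf)
  have 2: "?c (map_mat quat_fst (A * B)) = - ?c ?A2 * ?B2 + ?c ?A1 * ?c ?B1"
    using A B unfolding fst by (intro eq_matI)
      (simp_all add: scalar_prod_def sum_negf)
  show ?thesis
    unfolding companion_mat_def Let_def 1 2 unfolding fst snd
    using A B by (intro mult_four_block_mat[symmetric]) auto
qed

section \<open>The second-order trace\<close>

lemma trace_H2_eq:
  "trace_H2 A = ((trace_H1 A)\<^sup>2 - trace_H1 (A ^\<^sub>m 2)) / 2"
proof -
  have "det (mat_of_rows_list 2 [[a, b], [c, d]]) = a * d - b * c" for a b c d :: complex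
  proof -
    let ?M = "mat_of_rows_list 2 [[a, b], [c, d]]"
    have M: "?M \<in> carrier_mat 2 2"
      by (simp add: mat_of_rows_list_def numeral_2_eq_2)
    have "det ?M = (\<Sum>j<2. ?M $$ (0, j) * cofactor ?M 0 j)"
      by (rule laplace_expansion_row[OF M]) simp
    also have "\<dots> = a * d - b * c"
      by (simp add: numeral_2_eq_2 mat_of_rows_list_def cofactor_def det_single mat_delete_def)
    finally show ?thesis .
  qed
  then show ?thesis
    by (simp add: trace_H2_def power2_eq_square)
qed

lemma square_sum_eq_sum_squares:
  fixes f :: "nat \<Rightarrow> 'a :: comm_ring_1"
  shows "(\<Sum>k = 1..n. f k)\<^sup>2 =
    (\<Sum>k = 1..n. (f k)\<^sup>2) + 2 * (\<Sum>k = 1..n - 1. \<Sum>m = k + 1..n. f k * f m)"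
proof (induction n)
  case (Suc n)
  have "(\<Sum>k = 1..Suc n - 1. \<Sum>m = k + 1..Suc n. f k * f m)
      = (\<Sum>k = 1..n. (\<Sum>m = k + 1..n. f k * f m) + f k * f (Suc n))"
    by (intro sum.cong) auto
  also have "\<dots> = (\<Sum>k = 1..n. \<Sum>m = k + 1..n. f k * f m) + (\<Sum>k = 1..n. f k) * f (Suc n)"
    by (simp add: sum.distrib sum_distrib_right)
  \<comment> \<open>For \<open>k = n\<close> the inner sum is empty.\<close>
  also have "(\<Sum>k = 1..n. \<Sum>m = k + 1..n. f k * f m)
      = (\<Sum>k = 1..n - 1. \<Sum>m = k + 1..n. f k * f m)"
    by (cases n) simp_all
  finally show ?case
    using Suc.IH by (simp add: power2_eq_square algebra_simps)
qed simp

theorem proposition3p5: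
  fixes n :: nat and A :: "quat mat" and l :: "nat \<Rightarrow> complex"
  assumes "n \<ge> 2"
    and "A \<in> carrier_mat n n"
    and "standard_eigenvalues n A l"
  shows "trace_H2 A = complex_of_real
    ((\<Sum>k = 1..n. (cmod (l k))\<^sup>2) + 4 * (\<Sum>k = 1..n - 1. \<Sum>m = k + 1..n. Re (l k) * Re (l m)))"
proof -
  let ?C = "companion_mat A"
  let ?S = "\<Sum>k = 1..n. Re (l k)"
  have C: "?C \<in> carrier_mat (n + n) (n + n)"
    using companion_mat_carrier[OF assms(2)] .
  have roots: "proots (char_poly ?C) =
      image_mset l (mset_set {1..n}) + image_mset (\<lambda>k. cnj (l k)) (mset_set {1..n})"
    using assms(3) by (simp add: standard_eigenvalues_def)
  have power_trace: "mat_trace (?C ^\<^sub>m p) = (\<Sum>k = 1..n. of_real (2 * Re (l k ^ p)))" for p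
  proof -
    have "mat_trace (?C ^\<^sub>m p) = (\<Sum>k = 1..n. l k ^ p) + (\<Sum>k = 1..n. cnj (l k) ^ p)"
      unfolding mat_trace_pow_eq_sum_proots[OF C] roots
      by (simp add: image_mset.compositionality o_def sum_unfold_sum_mset)
    also have "\<dots> = (\<Sum>k = 1..n. of_real (2 * Re (l k ^ p)))"
      by (simp add: complex_add_cnj flip: sum.distrib complex_cnj_power)
    finally show ?thesis .
  qed
  have "trace_H1 A = of_real (2 * ?S)"
    using power_trace[of 1] C by (simp add: trace_H1_def sum_distrib_left)
  moreover have "trace_H1 (A ^\<^sub>m 2) = of_real (2 * (\<Sum>k = 1..n. (Re (l k))\<^sup>2 - (Im (l k))\<^sup>2))"
  proof -
    have "companion_mat (A ^\<^sub>m 2) = ?C ^\<^sub>m 2"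
      using assms(2) C by (simp add: numeral_2_eq_2 companion_mat_mult)
    then have "trace_H1 (A ^\<^sub>m 2) = (\<Sum>k = 1..n. of_real (2 * Re ((l k)\<^sup>2)))"
      unfolding trace_H1_def by (simp only: power_trace)
    then show ?thesis
      by (simp add: sum_distrib_left power2_eq_square)
  qed
  ultimately have "trace_H2 A =
      of_real (((2 * ?S)\<^sup>2 - 2 * (\<Sum>k = 1..n. (Re (l k))\<^sup>2 - (Im (l k))\<^sup>2)) / 2)"
    by (simp add: trace_H2_eq)
  also have "((2 * ?S)\<^sup>2 - 2 * (\<Sum>k = 1..n. (Re (l k))\<^sup>2 - (Im (l k))\<^sup>2)) / 2
      = (\<Sum>k = 1..n. (cmod (l k))\<^sup>2) + 4 * (\<Sum>k = 1..n - 1. \<Sum>m = k + 1..n. Re (l k) * Re (l m))"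
    using square_sum_eq_sum_squares[of "\<lambda>k. Re (l k)" n]
    by (simp add: power_mult_distrib cmod_power2 sum.distrib sum_subtractf)
  finally show ?thesis .
qed

end
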